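(* Let $E$ be the edge set of a finite graph. For each $e\in E$ let $(\Omega_1(e),\mu_1(e))$ and $(\Omega_2(e),\mu_2(e))$ be finite probability spaces, and let $\Omega=\prod_{e\in E}\big(\Omega_1(e)\cup\Omega_2(e)\big)$. Let $T$ be a generating decision tree, building a random configuration $C\in\Omega$. Let $T_1$ be any generating decision tree all of whose nodes have decision $1$ and $T_2$ any generating decision tree all of whose nodes have decision $2$, building random configurations $C_1$ and $C_2$ respectively. Let $A\subseteq\Omega$ be an event. For $e\in E$ and a configuration $\omega\in\Omega$ let, for $i\in\{1,2\}$, $X_i(\omega,e)$ be the set of those $x\in\Omega_i(e)$ for which the configuration obtained from $\omega$ by replacing its value at $e$ with $x$ belongs to $A$. Assume that for every $e\in E$ and every $\omega\in\Omega$, $$\mu_1(e)\big(X_1(\omega,e)\big)\le\mu_2(e)\big(X_2(\omega,e)\big).$$ Then $$\mathbf{P}(C_1\in A)\le\mathbf{P}(C\in A)\le\mathbf{P}(C_2\in A).$$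
   Context: A generating decision tree is a finite rooted tree in which each node $N$ carries an edge $e(N)\in E$ and a decision $D(N)\in\{1,2\}$. When a node $N$ with $D(N)=i$ is visited, a random element of $\Omega_i(e(N))$ is generated according to $\mu_i(e(N))$ (independently of everything generated before) and assigned to the edge $e(N)$; if $N$ is not a leaf, it has $|\Omega_i(e(N))|$ children indexed by the elements of $\Omega_i(e(N))$, and one moves to the child indexed by the generated element. Every path from the root to a leaf contains each edge of $E$ exactly once. Thus a run of the tree starting from the root assigns to every edge $e$ an element of $\Omega_1(e)\cup\Omega_2(e)$, producing a random configuration in $\Omega$; $\mathbf{P}$ denotes the induced distribution. In particular $C_i$ is distributed as the product measure $\prod_e\mu_i(e)$. *)

theory Defs
  imports "HOL-Probability.Probability"
begin

text \<open>
  A graph on the vertices \<open>V\<close> with edge set \<open>E\<close>, where \<open>ends e\<close> is the set of end points of \<open>e\<close>.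
  Loops and parallel edges are allowed.
\<close>

definition finite_graph :: "'v set \<Rightarrow> 'e set \<Rightarrow> ('e \<Rightarrow> 'v set) \<Rightarrow> bool" where
  "finite_graph V E ends \<longleftrightarrow>
     finite V \<and> finite E \<and> (\<forall>e\<in>E. ends e \<subseteq> V \<and> card (ends e) \<in> {1, 2})"

text \<open>
  The underlying set may be strictly larger than the support, i.e. it may have points of measure 0.
\<close>

definition finite_probability_space :: "'a set \<Rightarrow> 'a pmf \<Rightarrow> bool" where
  "finite_probability_space S \<mu> \<longleftrightarrow> finite S \<and> set_pmf \<mu> \<subseteq> S"

datatype decision = D1 | D2

definition configurations :: "'e set \<Rightarrow> (decision \<Rightarrow> 'e \<Rightarrow> 'a set) \<Rightarrow> ('e \<Rightarrow> 'a) set" where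
  "configurations E \<Omega> = (\<Pi>\<^sub>E e\<in>E. \<Omega> D1 e \<union> \<Omega> D2 e)"

text \<open>
  Leaves, like inner nodes, carry an edge and a decision. The children of \<open>Node e i ch\<close> are the
  trees \<open>ch x\<close> with \<open>x \<in> \<Omega> i e\<close>; the values of \<open>ch\<close> at other arguments are not part of the tree,
  and all functions below ignore them. Since each \<open>\<Omega> i e\<close> is finite, the tree is then finite.
\<close>

datatype ('e, 'a) decision_tree =
    Leaf 'e decision
  | Node 'e decision "'a \<Rightarrow> ('e, 'a) decision_tree"

primrec node_labels ::
    "(decision \<Rightarrow> 'e \<Rightarrow> 'a set) \<Rightarrow> ('e, 'a) decision_tree \<Rightarrow> ('e \<times> decision) set" where
  "node_labels \<Omega> (Leaf e i) = {(e, i)}"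
| "node_labels \<Omega> (Node e i ch) = insert (e, i) (\<Union>x\<in>\<Omega> i e. node_labels \<Omega> (ch x))"

text \<open>The sequences of edges met along the paths from the root to a leaf.\<close>

primrec root_leaf_paths ::
    "(decision \<Rightarrow> 'e \<Rightarrow> 'a set) \<Rightarrow> ('e, 'a) decision_tree \<Rightarrow> 'e list set" where
  "root_leaf_paths \<Omega> (Leaf e i) = {[e]}"
| "root_leaf_paths \<Omega> (Node e i ch) = (\<Union>x\<in>\<Omega> i e. (#) e ` root_leaf_paths \<Omega> (ch x))"

definition generating_decision_tree ::
    "'e set \<Rightarrow> (decision \<Rightarrow> 'e \<Rightarrow> 'a set) \<Rightarrow> ('e, 'a) decision_tree \<Rightarrow> bool" where
  "generating_decision_tree E \<Omega> T \<longleftrightarrow>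
     fst ` node_labels \<Omega> T \<subseteq> E \<and> (\<forall>p\<in>root_leaf_paths \<Omega> T. distinct p \<and> set p = E)"

text \<open>
  \<open>run \<mu> T w\<close> is the law of the configuration at the end of a run of \<open>T\<close> when \<open>w\<close> is the partial
  configuration generated before the root of \<open>T\<close> is visited.
\<close>

primrec run ::
    "(decision \<Rightarrow> 'e \<Rightarrow> 'a pmf) \<Rightarrow> ('e, 'a) decision_tree \<Rightarrow> ('e \<Rightarrow> 'a) \<Rightarrow> ('e \<Rightarrow> 'a) pmf" where
  "run \<mu> (Leaf e i) = (\<lambda>w. map_pmf (\<lambda>x. w(e := x)) (\<mu> i e))"
| "run \<mu> (Node e i ch) = (\<lambda>w. bind_pmf (\<mu> i e) (\<lambda>x. run \<mu> (ch x) (w(e := x))))"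

definition configuration_pmf ::
    "(decision \<Rightarrow> 'e \<Rightarrow> 'a pmf) \<Rightarrow> ('e, 'a) decision_tree \<Rightarrow> ('e \<Rightarrow> 'a) pmf" where
  "configuration_pmf \<mu> T = run \<mu> T (\<lambda>_. undefined)"

definition good_values ::
    "(decision \<Rightarrow> 'e \<Rightarrow> 'a set) \<Rightarrow> ('e \<Rightarrow> 'a) set \<Rightarrow> decision \<Rightarrow> ('e \<Rightarrow> 'a) \<Rightarrow> 'e \<Rightarrow> 'a set" where
  "good_values \<Omega> A i w e = {x \<in> \<Omega> i e. w(e := x) \<in> A}"

end

theory Submission imports Defs begin

text \<open>
  The idea is to convert the tree to one with the single decision \<open>i\<close> by changing one edge at a
  time, from the leaves upwards. Once every node strictly below a node \<open>N\<close> with edge \<open>e\<close> has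
  decision \<open>i\<close>, what happens after \<open>N\<close> is the independent sampling of the remaining edges from
  \<open>\<mu> i\<close>, whose outcome does not depend on the value given to \<open>e\<close>. Hence \<open>e\<close> may just as well be
  sampled last, when all the other edges already have values; and then the hypothesis on \<open>A\<close>
  compares the decisions \<open>D1\<close> and \<open>D2\<close> at \<open>e\<close>.

  The law that is reached in this way is \<open>resample (\<mu> i) R w\<close>: keep \<open>w\<close> outside the set \<open>R\<close> of
  the edges still to come and sample the edges in \<open>R\<close> independently. Both \<open>resample_insert_first\<close>
  and \<open>resample_insert_last\<close> describe it, according to whether \<open>e\<close> is sampled before or after the
  others. A tree whose nodes all have decision \<open>i\<close> has exactly this law
  (\<open>run_constant_decision\<close>), and an arbitrary tree is compared with it by induction, in
  \<open>expectation_resample_le_run\<close>.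

  To obtain both inequalities from one argument, the comparison is made for the expectation of a
  bounded real function \<open>f\<close> and for a decision \<open>i\<close> which makes this expectation smallest at each
  edge. The lower bound is the case where \<open>f\<close> is the indicator function of \<open>A\<close> and \<open>i = D1\<close>; the
  upper bound is the case where \<open>f\<close> is minus this indicator function and \<open>i = D2\<close>.
\<close>

section \<open>Independent sampling of a set of edges\<close>

definition resample :: "('e \<Rightarrow> 'a pmf) \<Rightarrow> 'e set \<Rightarrow> ('e \<Rightarrow> 'a) \<Rightarrow> ('e \<Rightarrow> 'a) pmf" where
  "resample q R w = map_pmf (\<lambda>g. override_on w g R) (Pi_pmf R undefined q)"

lemma resample_empty [simp]: "resample q {} w = return_pmf w"
  by (simp add: resample_def)

lemma resample_insert_last:
  assumes "finite R" "e \<notin> R"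
  shows "resample q (insert e R) w = bind_pmf (resample q R w) (\<lambda>v. map_pmf (\<lambda>x. v(e := x)) (q e))"
proof -
  have "override_on w (g(e := x)) (insert e R) = (override_on w g R)(e := x)" for g x
    using assms(2) by (auto simp: override_on_def fun_eq_iff)
  then show ?thesis
    unfolding resample_def Pi_pmf_insert'[OF assms] bind_map_pmf map_bind_pmf
    by (subst bind_commute_pmf) (simp add: map_pmf_def bind_return_pmf)
qed

lemma resample_insert_first:
  assumes "finite R" "e \<notin> R"
  shows "resample q (insert e R) w = bind_pmf (q e) (\<lambda>x. resample q R (w(e := x)))"
proof -
  have "override_on (w(e := x)) g R = (override_on w g R)(e := x)" for g x
    using assms(2) by (auto simp: override_on_def fun_eq_iff)
  then show ?thesis
    unfolding resample_insert_last[OF assms] map_pmf_def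
    by (subst bind_commute_pmf) (simp add: resample_def map_pmf_def bind_assoc_pmf bind_return_pmf)
qed

text \<open>
  The edge \<open>e\<close> may be sampled before or after those in \<open>R\<close>, also when its law \<open>p\<close> is not the one
  that \<open>q\<close> prescribes: this is the exchange of the two descriptions of \<open>resample\<close>, with the entry
  \<open>p\<close> put into \<open>q\<close> at \<open>e\<close>.
\<close>

lemma bind_resample_update:
  assumes "finite R" "e \<notin> R"
  shows "bind_pmf p (\<lambda>x. resample q R (w(e := x)))
       = bind_pmf (resample q R w) (\<lambda>v. map_pmf (\<lambda>x. v(e := x)) p)"
proof -
  have *: "resample (q(e := p)) R = resample q R"
    unfolding resample_def fun_eq_iff using assms
    by (auto intro!: arg_cong[where f = "map_pmf _"] Pi_pmf_cong)
  show ?thesis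
    using resample_insert_first[OF assms, of "q(e := p)" w]
      resample_insert_last[OF assms, of "q(e := p)" w] by (simp add: *)
qed

lemma resample_configurations:
  assumes "finite R" "R \<subseteq> S" "w \<in> configurations (S - R) \<Omega>" "v \<in> set_pmf (resample q R w)"
    and "\<And>e. e \<in> R \<Longrightarrow> set_pmf (q e) \<subseteq> \<Omega> D1 e \<union> \<Omega> D2 e"
  shows "v \<in> configurations S \<Omega>"
proof -
  from assms(1,4) obtain g where g: "g \<in> PiE_dflt R undefined (\<lambda>e. set_pmf (q e))"
    and v: "v = override_on w g R"
    by (auto simp: resample_def set_Pi_pmf comp_def)
  have "g e \<in> \<Omega> D1 e \<union> \<Omega> D2 e" if "e \<in> R" for e
    using g assms(5)[OF that] that by (auto simp: PiE_dflt_def)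
  then show ?thesis
    using assms(2,3) unfolding v configurations_def PiE_def extensional_def Pi_def override_on_def
    by auto
qed

section \<open>Subtrees of generating decision trees\<close>

lemma node_labels_nonempty: "node_labels \<Omega> T \<noteq> {}"
  by (cases T) auto

text \<open>
  A node without children would be the end of no path to a leaf, and the condition on the paths
  would say nothing about the labels above it. When the value sets are nonempty, every node lies on
  a path to a leaf. This is needed to pass to a subtree: the paths in the subtree avoid the edge at
  the root, and the labels have to avoid it too.
\<close>

lemma node_labels_on_root_leaf_paths:
  assumes "\<And>e i. (e, i) \<in> node_labels \<Omega> T \<Longrightarrow> \<Omega> i e \<noteq> {}"
  shows "fst ` node_labels \<Omega> T = \<Union> (set ` root_leaf_paths \<Omega> T)"
  using assms
proof (induction T)
  case (Node e i ch)
  have IH: "fst ` node_labels \<Omega> (ch x) = \<Union> (set ` root_leaf_paths \<Omega> (ch x))" if "x \<in> \<Omega> i e" for x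
    by (rule Node.IH[OF rangeI Node.prems]) (use that in auto)
  obtain x where x: "x \<in> \<Omega> i e"
    using Node.prems[of e i] by auto
  have "root_leaf_paths \<Omega> (ch x) \<noteq> {}"
    using IH[OF x] node_labels_nonempty[of \<Omega> "ch x"] by auto
  then have ne: "e \<in> \<Union> (set ` root_leaf_paths \<Omega> (Node e i ch))"
    using x by auto
  have "fst ` node_labels \<Omega> (Node e i ch) = insert e (\<Union>x\<in>\<Omega> i e. fst ` node_labels \<Omega> (ch x))"
    by (simp add: image_UN)
  also have "\<dots> = insert e (\<Union>x\<in>\<Omega> i e. \<Union> (set ` root_leaf_paths \<Omega> (ch x)))"
    using IH by simp
  also have "\<dots> = insert e (\<Union> (set ` root_leaf_paths \<Omega> (Node e i ch)))"
    using ne by auto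
  finally show ?case
    using ne by (simp add: insert_absorb)
qed auto

lemma generating_decision_tree_child:
  assumes T: "generating_decision_tree R \<Omega> (Node e i ch)" and x: "x \<in> \<Omega> i e"
    and \<Omega>: "\<And>i e. e \<in> R \<Longrightarrow> \<Omega> i e \<noteq> {}"
  shows "generating_decision_tree (R - {e}) \<Omega> (ch x)"
proof -
  have paths: "distinct p \<and> set p = R - {e}" if "p \<in> root_leaf_paths \<Omega> (ch x)" for p
    using T that x by (fastforce simp: generating_decision_tree_def)
  have "fst ` node_labels \<Omega> (ch x) \<subseteq> R"
    using T x by (auto simp: generating_decision_tree_def)
  then have "fst ` node_labels \<Omega> (ch x) = \<Union> (set ` root_leaf_paths \<Omega> (ch x))"
    using \<Omega> by (intro node_labels_on_root_leaf_paths) force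
  then show ?thesis
    using paths by (auto simp: generating_decision_tree_def)
qed

lemma generating_decision_tree_root_in:
  "generating_decision_tree R \<Omega> (Node e i ch) \<Longrightarrow> e \<in> R"
  by (simp add: generating_decision_tree_def)

lemma generating_decision_tree_Leaf:
  "generating_decision_tree R \<Omega> (Leaf e i) \<longleftrightarrow> R = {e}"
  by (auto simp: generating_decision_tree_def)

section \<open>Trees with a single decision\<close>

lemma run_constant_decision:
  assumes "generating_decision_tree R \<Omega> T" "finite R"
    and "\<And>i e. e \<in> R \<Longrightarrow> set_pmf (\<mu> i e) \<subseteq> \<Omega> i e"
    and "\<forall>N\<in>node_labels \<Omega> T. snd N = i"
  shows "run \<mu> T w = resample (\<mu> i) R w"
  using assms
proof (induction T arbitrary: R w)
  case (Leaf e j)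
  then show ?case
    using resample_insert_first[of "{}" e "\<mu> i" w]
    by (simp add: generating_decision_tree_Leaf map_pmf_def)
next
  case (Node e j ch)
  have e: "e \<in> R"
    by (rule generating_decision_tree_root_in[OF Node.prems(1)])
  have ne: "\<Omega> i' e' \<noteq> {}" if "e' \<in> R" for i' e'
    using Node.prems(3)[OF that] set_pmf_not_empty[of "\<mu> i' e'"] by auto
  have j: "j = i"
    using Node.prems(4) by simp
  have "run \<mu> (ch x) (w(e := x)) = resample (\<mu> i) (R - {e}) (w(e := x))" if "x \<in> set_pmf (\<mu> i e)" for x
  proof -
    have x: "x \<in> \<Omega> i e"
      using that Node.prems(3)[OF e] by auto
    show ?thesis
      using Node.prems x generating_decision_tree_child[OF Node.prems(1) _ ne] j
      by (intro Node.IH) auto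
  qed
  then show ?case
    using resample_insert_first[of "R - {e}" e "\<mu> i" w] Node.prems(2) e j
    by (auto simp: insert_absorb intro!: bind_pmf_cong)
qed

section \<open>Expectations of bounded functions\<close>

lemma expectation_bind_pmf_bounded:
  fixes f :: "'b \<Rightarrow> real"
  assumes "\<And>x. \<bar>f x\<bar> \<le> B"
  shows "measure_pmf.expectation (bind_pmf p k) f
       = measure_pmf.expectation p (\<lambda>x. measure_pmf.expectation (k x) f)"
proof -
  interpret N: prob_space "measure_pmf (bind_pmf p k)"
    by (rule measure_pmf.prob_space_axioms)
  show ?thesis
    unfolding measure_pmf_bind
    by (rule integral_bind[where K = "count_space UNIV" and B = B and B' = 1])
      (use assms in \<open>auto simp: measure_pmf_in_subprob_algebra measure_pmf.emeasure_space_1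
          intro: measure_pmf.finite_measure_axioms\<close>)
qed

lemma expectation_pmf_mono_bounded:
  fixes f g :: "'b \<Rightarrow> real"
  assumes "\<And>x. \<bar>f x\<bar> \<le> B" "\<And>x. \<bar>g x\<bar> \<le> B" "\<And>x. x \<in> set_pmf p \<Longrightarrow> f x \<le> g x"
  shows "measure_pmf.expectation p f \<le> measure_pmf.expectation p g"
  by (rule integral_mono_AE)
    (use assms in \<open>auto simp: AE_measure_pmf_iff intro: measure_pmf.integrable_const_bound[of _ B]\<close>)

lemma abs_expectation_pmf_le:
  fixes f :: "'b \<Rightarrow> real"
  assumes "\<And>x. \<bar>f x\<bar> \<le> B"
  shows "\<bar>measure_pmf.expectation p f\<bar> \<le> B"
proof -
  have "\<bar>measure_pmf.expectation p f\<bar> \<le> measure_pmf.expectation p (\<lambda>x. \<bar>f x\<bar>)"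
    by (rule integral_abs_bound)
  also have "\<dots> \<le> measure_pmf.expectation p (\<lambda>_. B)"
    by (rule expectation_pmf_mono_bounded[where B = "\<bar>B\<bar>"]) (use assms in \<open>auto intro: order_trans[OF _ abs_ge_self]\<close>)
  finally show ?thesis by simp
qed

section \<open>Comparison of an arbitrary tree with a single decision\<close>

text \<open>
  In the last hypothesis \<open>v\<close> is a configuration without a value at \<open>e\<close>: at the moment when \<open>e\<close> is
  sampled last, no value has been given to it.
\<close>

context
  fixes E :: "'e set" and \<Omega> :: "decision \<Rightarrow> 'e \<Rightarrow> 'a set" and \<mu> :: "decision \<Rightarrow> 'e \<Rightarrow> 'a pmf"
    and f :: "('e \<Rightarrow> 'a) \<Rightarrow> real" and B :: real and i :: decision
  assumes finite_E: "finite E"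
    and supp: "\<And>j e. e \<in> E \<Longrightarrow> set_pmf (\<mu> j e) \<subseteq> \<Omega> j e"
    and bounded: "\<And>v. \<bar>f v\<bar> \<le> B"
    and le: "\<And>j e v. e \<in> E \<Longrightarrow> v \<in> configurations (E - {e}) \<Omega> \<Longrightarrow>
        measure_pmf.expectation (\<mu> i e) (\<lambda>x. f (v(e := x)))
          \<le> measure_pmf.expectation (\<mu> j e) (\<lambda>x. f (v(e := x)))"
begin

text \<open>
  The edge \<open>e\<close> is moved to the end, where the hypothesis applies to each outcome of the other edges,
  then its law is changed from \<open>\<mu> i e\<close> to \<open>\<mu> j e\<close>, and it is moved back to the beginning.
\<close>

lemma expectation_resample_change_edge:
  assumes R: "insert e R \<subseteq> E" "e \<notin> R" and w: "w \<in> configurations (E - insert e R) \<Omega>"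
  shows "measure_pmf.expectation (resample (\<mu> i) (insert e R) w) f
       \<le> measure_pmf.expectation (\<mu> j e) (\<lambda>x. measure_pmf.expectation (resample (\<mu> i) R (w(e := x))) f)"
proof -
  have fin: "finite R"
    using finite_subset[OF R(1) finite_E] by simp
  have conf: "v \<in> configurations (E - {e}) \<Omega>" if "v \<in> set_pmf (resample (\<mu> i) R w)" for v
  proof (rule resample_configurations[OF fin _ _ that])
    show "R \<subseteq> E - {e}"
      using R by auto
    show "w \<in> configurations (E - {e} - R) \<Omega>"
      using w by (simp flip: Diff_insert2)
    show "set_pmf (\<mu> i e') \<subseteq> \<Omega> D1 e' \<union> \<Omega> D2 e'" if "e' \<in> R" for e'
      using supp[of e' i] R(1) that by (cases i) auto
  qed
  have "measure_pmf.expectation (resample (\<mu> i) (insert e R) w) f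
      = measure_pmf.expectation (resample (\<mu> i) R w)
          (\<lambda>v. measure_pmf.expectation (\<mu> i e) (\<lambda>x. f (v(e := x))))"
    by (simp add: resample_insert_last[OF fin R(2)] expectation_bind_pmf_bounded[of f, OF bounded])
  also have "\<dots> \<le> measure_pmf.expectation (resample (\<mu> i) R w)
          (\<lambda>v. measure_pmf.expectation (\<mu> j e) (\<lambda>x. f (v(e := x))))"
    using R(1) by (intro expectation_pmf_mono_bounded[where B = B] abs_expectation_pmf_le bounded le conf) auto
  also have "\<dots> = measure_pmf.expectation (bind_pmf (\<mu> j e) (\<lambda>x. resample (\<mu> i) R (w(e := x)))) f"
    by (simp add: bind_resample_update[OF fin R(2)] expectation_bind_pmf_bounded[of f, OF bounded])
  also have "\<dots> = measure_pmf.expectation (\<mu> j e)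
      (\<lambda>x. measure_pmf.expectation (resample (\<mu> i) R (w(e := x))) f)"
    by (rule expectation_bind_pmf_bounded[OF bounded])
  finally show ?thesis .
qed

text \<open>
  Induction on the tree. By the lemma above, the root may be given its decision \<open>j\<close> while the edges
  below it are still sampled from \<open>\<mu> i\<close>; the induction hypothesis replaces the latter by the
  subtree that the run enters.
\<close>

lemma expectation_resample_le_run:
  assumes "generating_decision_tree R \<Omega> T" "R \<subseteq> E" "w \<in> configurations (E - R) \<Omega>"
  shows "measure_pmf.expectation (resample (\<mu> i) R w) f \<le> measure_pmf.expectation (run \<mu> T w) f"
  using assms
proof (induction T arbitrary: R w)
  case (Leaf e j)
  then show ?case
    using expectation_resample_change_edge[of e "{}" w j]
    by (simp add: generating_decision_tree_Leaf)
next
  case (Node e j ch)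
  have e: "e \<in> R"
    by (rule generating_decision_tree_root_in[OF Node.prems(1)])
  then have eE: "e \<in> E" and R: "insert e (R - {e}) = R"
    using Node.prems(2) by auto
  have ne: "\<Omega> i' e' \<noteq> {}" if "e' \<in> R" for i' e'
    using supp[of e' i'] set_pmf_not_empty[of "\<mu> i' e'"] Node.prems(2) that by auto
  have "measure_pmf.expectation (resample (\<mu> i) R w) f
      \<le> measure_pmf.expectation (\<mu> j e)
          (\<lambda>x. measure_pmf.expectation (resample (\<mu> i) (R - {e}) (w(e := x))) f)"
    using expectation_resample_change_edge[of e "R - {e}" w j] R eE Node.prems by simp
  also have "\<dots> \<le> measure_pmf.expectation (\<mu> j e)
          (\<lambda>x. measure_pmf.expectation (run \<mu> (ch x) (w(e := x))) f)"
  proof (intro expectation_pmf_mono_bounded[where B = B] abs_expectation_pmf_le bounded)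
    fix x assume "x \<in> set_pmf (\<mu> j e)"
    then have x: "x \<in> \<Omega> j e"
      using supp[OF eE] by auto
    have "E - (R - {e}) = insert e (E - R)"
      using eE by auto
    moreover have "x \<in> \<Omega> D1 e \<union> \<Omega> D2 e"
      using x by (cases j) auto
    ultimately have "w(e := x) \<in> configurations (E - (R - {e})) \<Omega>"
      using Node.prems(3) unfolding configurations_def by (simp only: PiE_fun_upd)
    then show "measure_pmf.expectation (resample (\<mu> i) (R - {e}) (w(e := x))) f
        \<le> measure_pmf.expectation (run \<mu> (ch x) (w(e := x))) f"
      using Node.prems(2)
      by (intro Node.IH[OF rangeI generating_decision_tree_child[OF Node.prems(1) x ne]]) blast+
  qed
  also have "\<dots> = measure_pmf.expectation (run \<mu> (Node e j ch) w) f"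
    by (simp add: expectation_bind_pmf_bounded[of f, OF bounded])
  finally show ?case .
qed

lemma expectation_constant_decision_le:
  assumes "generating_decision_tree E \<Omega> T'" "\<forall>N\<in>node_labels \<Omega> T'. snd N = i"
    and "generating_decision_tree E \<Omega> T"
  shows "measure_pmf.expectation (configuration_pmf \<mu> T') f
       \<le> measure_pmf.expectation (configuration_pmf \<mu> T) f"
proof -
  have "(\<lambda>_. undefined) \<in> configurations (E - E) \<Omega>"
    by (simp add: configurations_def)
  then show ?thesis
    using run_constant_decision[OF assms(1) finite_E supp assms(2)]
      expectation_resample_le_run[OF assms(3) order_refl] supp
    by (simp add: configuration_pmf_def)
qed

end

section \<open>Comparison of probabilities\<close>

theorem lemma8p1:
  fixes V :: "'v set" and E :: "'e set" and ends :: "'e \<Rightarrow> 'v set"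
    and \<Omega> :: "decision \<Rightarrow> 'e \<Rightarrow> 'a set" and \<mu> :: "decision \<Rightarrow> 'e \<Rightarrow> 'a pmf"
    and T T1 T2 :: "('e, 'a) decision_tree" and A :: "('e \<Rightarrow> 'a) set"
  assumes "finite_graph V E ends"
    and "\<And>i e. e \<in> E \<Longrightarrow> finite_probability_space (\<Omega> i e) (\<mu> i e)"
    and "generating_decision_tree E \<Omega> T"
    and "generating_decision_tree E \<Omega> T1" and "\<forall>N\<in>node_labels \<Omega> T1. snd N = D1"
    and "generating_decision_tree E \<Omega> T2" and "\<forall>N\<in>node_labels \<Omega> T2. snd N = D2"
    and "A \<subseteq> configurations E \<Omega>"
    and "\<And>e w. e \<in> E \<Longrightarrow> w \<in> configurations E \<Omega> \<Longrightarrow>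
           measure_pmf.prob (\<mu> D1 e) (good_values \<Omega> A D1 w e)
             \<le> measure_pmf.prob (\<mu> D2 e) (good_values \<Omega> A D2 w e)"
  shows "measure_pmf.prob (configuration_pmf \<mu> T1) A \<le> measure_pmf.prob (configuration_pmf \<mu> T) A
       \<and> measure_pmf.prob (configuration_pmf \<mu> T) A \<le> measure_pmf.prob (configuration_pmf \<mu> T2) A"
proof -
  have fin: "finite E"
    using assms(1) by (simp add: finite_graph_def)
  have supp: "set_pmf (\<mu> j e) \<subseteq> \<Omega> j e" if "e \<in> E" for j e
    using assms(2)[OF that] by (simp add: finite_probability_space_def)
  have good: "measure_pmf.expectation (\<mu> j e) (\<lambda>x. indicator A (v(e := x)))
      = measure_pmf.prob (\<mu> j e) (good_values \<Omega> A j v e)" if "e \<in> E" for j e v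
  proof -
    have "measure_pmf.expectation (\<mu> j e) (\<lambda>x. indicator A (v(e := x)))
        = measure_pmf.expectation (\<mu> j e) (indicator (good_values \<Omega> A j v e) :: _ \<Rightarrow> real)"
      using supp[OF that, of j]
      by (intro integral_cong_AE) (auto simp: AE_measure_pmf_iff good_values_def indicator_def)
    then show ?thesis by simp
  qed
  \<comment> \<open>The set of good values at \<open>e\<close> does not depend on the value of the configuration at \<open>e\<close>, so
    any value may be put there to obtain a configuration on all of \<open>E\<close>.\<close>
  have le: "measure_pmf.prob (\<mu> D1 e) (good_values \<Omega> A D1 v e)
      \<le> measure_pmf.prob (\<mu> D2 e) (good_values \<Omega> A D2 v e)"
    if e: "e \<in> E" and v: "v \<in> configurations (E - {e}) \<Omega>" for e v
  proof -
    obtain x where "x \<in> \<Omega> D1 e"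
      using supp[OF e, of D1] set_pmf_not_empty[of "\<mu> D1 e"] by auto
    then have "v(e := x) \<in> configurations (insert e (E - {e})) \<Omega>"
      using v unfolding configurations_def by (intro PiE_fun_upd) auto
    then have "v(e := x) \<in> configurations E \<Omega>"
      using e by (simp add: insert_absorb)
    from assms(9)[OF e this] show ?thesis
      by (simp add: good_values_def)
  qed
  have "measure_pmf.expectation (configuration_pmf \<mu> T1) (indicator A :: _ \<Rightarrow> real)
      \<le> measure_pmf.expectation (configuration_pmf \<mu> T) (indicator A)"
  proof (rule expectation_constant_decision_le[OF fin supp _ _ assms(4,5,3), where B = 1])
    fix j e v assume "e \<in> E" "v \<in> configurations (E - {e}) \<Omega>"
    then show "measure_pmf.expectation (\<mu> D1 e) (\<lambda>x. indicator A (v(e := x)) :: real)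
        \<le> measure_pmf.expectation (\<mu> j e) (\<lambda>x. indicator A (v(e := x)))"
      by (cases j) (simp_all add: good le)
  qed (auto simp: indicator_def)
  moreover have "measure_pmf.expectation (configuration_pmf \<mu> T2) (\<lambda>v. - indicator A v :: real)
      \<le> measure_pmf.expectation (configuration_pmf \<mu> T) (\<lambda>v. - indicator A v)"
  proof (rule expectation_constant_decision_le[OF fin supp _ _ assms(6,7,3), where B = 1])
    fix j e v assume "e \<in> E" "v \<in> configurations (E - {e}) \<Omega>"
    then show "measure_pmf.expectation (\<mu> D2 e) (\<lambda>x. - indicator A (v(e := x)) :: real)
        \<le> measure_pmf.expectation (\<mu> j e) (\<lambda>x. - indicator A (v(e := x)))"
      by (cases j) (simp_all add: good le)
  qed (auto simp: indicator_def)
  ultimately show ?thesis by simp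
qed

end
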